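(* In the setting described in the context (uniform-grid model with $\beta=1$, kernel $K$ satisfying the kernel assumption, estimator $\hat f=\hat\iota/\Delta t$), assume $\Delta t \preccurlyeq 1$. Then, for $x_0\in[0,1]^d$, $$\mathbf{E}\big[\|\hat f(x_0)-f^\star(x_0)\|_2^2\big] \preccurlyeq (\Delta t^2\, n)^{-\frac{2}{2+d}} + \Delta t^2 .$$
   Context: Asymptotic notation (as $n\to\infty$): $a_n\preccurlyeq b_n$ means $\limsup_{n\to\infty} a_n/b_n<\infty$; $a_n\asymp b_n$ means $a_n\preccurlyeq b_n$ and $b_n\preccurlyeq a_n$. The quantities $d$, $L_0,L_1$, $\sigma$, $K$ are fixed; all other quantities (in particular $\Delta t$) may vary with $n$. Flow and increment: for a Lipschitz $f\colon\mathbb R^d\to\mathbb R^d$, $U(f,x,\cdot)$ is the unique solution $u$ of $\dot u(t)=f(u(t))$, $u(0)=x$. The increment map is $\Upsilon(f,\Delta t,x):=U(f,x,\Delta t)-x$. Smoothness class: $\mathcal F$ is the set of continuously differentiable $f\colon\mathbb R^d\to\mathbb R^d$ with $\sup_x\|f(x)\|_2\le L_0$ and $\sup_x\|Df(x)\|_{\mathsf{op}}\le L_1$, where $L_0,L_1>0$. Model: $d\in\mathbb N$, $f^\star\in\mathcal F$, $n_0\in\mathbb N$, $n:=n_0^d$, and $\{x_1,\dots,x_n\}=\{(k_1/n_0,\dots,k_d/n_0)^\top : k_1,\dots,k_d\in\{1,\dots,n_0\}\}$. Let $\sigma\ge 0$, let $\varepsilon_1,\dots,\varepsilon_n$ be independent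 $\mathbb R^d$-valued random variables with $\mathbf E[\varepsilon_j]=0$, $\mathbf E[\|\varepsilon_j\|_2^2]\le\sigma^2$, let $\Delta t>0$, and observe $Y_j:=U(f^\star,x_j,\Delta t)+\varepsilon_j$, $j=1,\dots,n$. Kernel assumption: $K\colon[0,\infty)\to\mathbb R$ is Lipschitz continuous, nonnegative, not identically zero, and there is $C_{\mathsf{ker}}>0$ with $K(z)\le C_{\mathsf{ker}}\mathbf 1_{[0,1]}(z)$ for all $z\ge0$. Estimator: $\hat\iota$ is the local constant (Nadaraya--Watson) estimator of $\iota^\star:=\Upsilon(f^\star,\Delta t,\cdot)$ with kernel $K$ and bandwidth $h$, applied to each component: $\hat\iota(x)\in\arg\min_{\theta\in\mathbb R^d}\sum_{j=1}^n\|Y_j-x_j-\theta\|_2^2\,K(\|x_j-x\|_2/h)$, that is, $\hat\iota(x)=\sum_j (Y_j-x_j)K(\|x_j-x\|_2/h)/\sum_j K(\|x_j-x\|_2/h)$ when the denominator is positive. The bandwidth is of the optimal order, $h\asymp(\Delta t^2 n)^{-1/(2+d)}$ (the optimal order for estimating a Lipschitz function with Lipschitz constant of order $\Delta t$ on $[0,1]^d$ from $n$ observations). Finally $\hat f(x):=\hat\iota(x)/\Delta t$.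
   Formalization: The bandwidth is additionally assumed to satisfy h ≤ √d/2 for all large n (automatic if Δt² n → ∞); without it the claim fails, e.g. f* = 0, K(0) > 0, σ > 0, Δt = 1/n, where the risk is of order n but the bound is n^{2/(2+d)}. *)

theory Defs
  imports "HOL-Probability.Probability"
begin

text \<open>
  Asymptotic comparison of nonnegative sequences. The sequences take values in \<^typ>\<open>ennreal\<close>, so
  that a mean squared error that is infinite is not mistaken for a small one.
\<close>

definition asymp_le :: "(nat \<Rightarrow> ennreal) \<Rightarrow> (nat \<Rightarrow> ennreal) \<Rightarrow> bool"
  where "asymp_le a b \<longleftrightarrow> limsup (\<lambda>n. a n / b n) < \<infinity>"

definition same_order :: "(nat \<Rightarrow> ennreal) \<Rightarrow> (nat \<Rightarrow> ennreal) \<Rightarrow> bool"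
  where "same_order a b \<longleftrightarrow> asymp_le a b \<and> asymp_le b a"

text \<open>
  The solution is taken on the whole time axis, which determines it uniquely as a function on
  \<^typ>\<open>real\<close> when \<open>f\<close> is Lipschitz; for other \<open>f\<close> the value is unspecified.
\<close>

definition flow :: "('a::real_normed_vector \<Rightarrow> 'a) \<Rightarrow> 'a \<Rightarrow> real \<Rightarrow> 'a"
  where "flow f x =
    (THE u. u 0 = x \<and> (\<forall>t. (u has_vector_derivative f (u t)) (at t)))"

definition smooth_class :: "real \<Rightarrow> real \<Rightarrow> ('a::real_normed_vector \<Rightarrow> 'a) set"
  where "smooth_class L0 L1 = {f. (\<forall>x. norm (f x) \<le> L0) \<and>
    (\<exists>Df :: 'a \<Rightarrow> 'a \<Rightarrow>\<^sub>L 'a. continuous_on UNIV Df \<and>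
      (\<forall>x. (f has_derivative blinfun_apply (Df x)) (at x) \<and> norm (Df x) \<le> L1))}"

definition unit_grid :: "nat \<Rightarrow> (real ^ 'd) set"
  where "unit_grid n0 = {v. \<forall>i. \<exists>k\<in>{1..n0}. v $ i = real k / real n0}"

definition smoothing_kernel :: "(real \<Rightarrow> real) \<Rightarrow> bool"
  where "smoothing_kernel K \<longleftrightarrow>
    (\<exists>L. L-lipschitz_on {0..} K) \<and>
    (\<forall>z\<ge>0. 0 \<le> K z) \<and>
    (\<exists>z\<ge>0. K z \<noteq> 0) \<and>
    (\<exists>C>0. \<forall>z\<ge>0. K z \<le> C * indicator {0..1} z)"

definition centred_noise ::
  "'w measure \<Rightarrow> real \<Rightarrow> nat set \<Rightarrow> (nat \<Rightarrow> 'w \<Rightarrow> 'a::euclidean_space) \<Rightarrow> bool"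
  where "centred_noise M \<sigma> J \<epsilon> \<longleftrightarrow>
    prob_space M \<and>
    prob_space.indep_vars M (\<lambda>_. borel) \<epsilon> J \<and>
    (\<forall>j\<in>J. integrable M (\<epsilon> j) \<and> (\<integral>\<omega>. \<epsilon> j \<omega> \<partial>M) = 0 \<and>
      integrable M (\<lambda>\<omega>. (norm (\<epsilon> j \<omega>))\<^sup>2) \<and> (\<integral>\<omega>. (norm (\<epsilon> j \<omega>))\<^sup>2 \<partial>M) \<le> \<sigma>\<^sup>2)"

text \<open>
  A value of the local constant (Nadaraya--Watson) estimator at \<open>v\<close> for the data
  \<open>(x j, y j)\<close>, \<open>j \<in> J\<close>. It is unique exactly when the weights do not all vanish; otherwise
  every \<open>\<theta>\<close> qualifies.
\<close>

definition local_constant_estimate ::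
  "(real \<Rightarrow> real) \<Rightarrow> real \<Rightarrow> nat set \<Rightarrow> (nat \<Rightarrow> 'a::real_normed_vector) \<Rightarrow> (nat \<Rightarrow> 'a) \<Rightarrow> 'a \<Rightarrow> 'a \<Rightarrow> bool"
  where "local_constant_estimate K h J x y v \<theta> \<longleftrightarrow>
    is_arg_min (\<lambda>\<theta>. \<Sum>j\<in>J. (norm (y j - \<theta>))\<^sup>2 * K (norm (x j - v) / h)) (\<lambda>_. True) \<theta>"

end

theory Submission
  imports Defs "HOL-Real_Asymp.Real_Asymp"
begin

text \<open>
  The estimator is a weighted mean of the observed increments. Along a trajectory of length \<open>\<Delta>t\<close>
  started within \<open>h\<close> of \<open>x0\<close> the vector field differs from \<open>f x0\<close> by at most
  \<open>L1 * (h + L0 * \<Delta>t)\<close>, which bounds the bias of \<open>f_hat\<close>. The variance of the weighted noise is at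
  most \<open>\<sigma>\<^sup>2\<close> times the largest weight, hence of order \<open>1 / (n * h ^ d)\<close> once the kernel mass near \<open>x0\<close> is
  seen to be of order at least \<open>n * h ^ d\<close>. This needs \<open>h\<close> to be at most half the diameter of the cube and
  of larger order than the mesh, which the boundedness of \<open>\<Delta>t\<close> guarantees. After division by
  \<open>\<Delta>t\<^sup>2\<close> the order of the bandwidth balances \<open>h\<^sup>2\<close> and the variance.
\<close>

section \<open>The flow of a Lipschitz vector field\<close>

text \<open>Integrating \<open>B * exp (a * s)\<close> from 0 costs a factor \<open>1 / a\<close>.
  In the norm weighted by \<open>exp (- (a * \<bar>t\<bar>))\<close> this makes integration a
  contraction once \<open>a\<close> beats the Lipschitz constant, which serves both uniqueness and
  existence below. Negative times reduce to positive ones by reflection.\<close>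

lemma norm_antiderivative_le_exp:
  fixes G g :: "real \<Rightarrow> 'a::real_normed_vector"
  assumes "a > 0"
    and deriv: "\<And>t. (G has_vector_derivative g t) (at t)"
    and "G 0 = 0"
    and bound: "\<And>t. norm (g t) \<le> B * exp (a * \<bar>t\<bar>)"
  shows "norm (G t) \<le> B / a * exp (a * \<bar>t\<bar>)"
proof -
  \<comment> \<open>Stated for arbitrary \<open>F\<close> and \<open>f\<close>, because the
    reflected function \<open>G (- s)\<close> is a second instance.\<close>
  have half: "norm (F t) \<le> B / a * exp (a * t)"
    if F: "\<And>t. (F has_vector_derivative f t) (at t)" "F 0 = 0"
      and f: "\<And>t. norm (f t) \<le> B * exp (a * \<bar>t\<bar>)" and t: "t \<ge> 0"
    for F f :: "real \<Rightarrow> 'a" and t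
  proof -
    have B: "B \<ge> 0" using order_trans[OF norm_ge_zero f[of 0]] by simp
    show ?thesis
    proof (cases "t = 0")
      case True
      then show ?thesis using F B \<open>a > 0\<close> by simp
    next
      case False
      have "norm (F t - F 0) \<le> B / a * exp (a * t) - B / a * exp (a * 0)"
      proof (rule differentiable_bound_general[where f' = f and \<phi>' = "\<lambda>s. B * exp (a * s)"])
        show "continuous_on {0..t} F"
          using F(1) by (meson continuous_at_imp_continuous_on has_vector_derivative_continuous)
        show "((\<lambda>s. B / a * exp (a * s)) has_vector_derivative B * exp (a * s)) (at s)" for s
          using \<open>a > 0\<close>
          by (auto intro!: derivative_eq_intros simp flip: has_real_derivative_iff_has_vector_derivative)
        show "norm (f s) \<le> B * exp (a * s)" if "0 < s" for s
          using f[of s] that by simp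
      qed (use F t False \<open>a > 0\<close> in \<open>auto intro!: continuous_intros\<close>)
      moreover have "B / a * exp (a * 0) \<ge> 0" using B \<open>a > 0\<close> by simp
      ultimately show ?thesis using F(2) by simp
    qed
  qed
  show ?thesis
  proof (cases "t \<ge> 0")
    case True
    then show ?thesis using half[of G g t] assms by simp
  next
    case False
    have "((\<lambda>s. G (- s)) has_vector_derivative - g (- s)) (at s)" for s
      using vector_diff_chain_at[OF has_vector_derivative_minus[OF has_vector_derivative_id], where g = G]
        deriv by (auto simp: o_def)
    then have "norm (G (- (- t))) \<le> B / a * exp (a * - t)"
      using half[of "\<lambda>s. G (- s)" "\<lambda>s. - g (- s)" "- t"] False \<open>G 0 = 0\<close> bound
      by (auto simp del: minus_minus) (metis abs_minus_cancel bound norm_minus_cancel)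
    then show ?thesis using False by simp
  qed
qed

text \<open>Boundedness of \<open>f\<close> gives a first exponential bound on the difference of two
  solutions. Feeding a bound back through the integral equation multiplies it by at most
  \<open>\<bar>L\<bar> / a\<close>, hence by at most 1/2, so the difference is zero in the
  limit.\<close>

lemma ode_unique:
  fixes f :: "'a::real_normed_vector \<Rightarrow> 'a"
  assumes lip: "\<And>x y. norm (f x - f y) \<le> L * norm (x - y)"
    and bounded: "\<And>x. norm (f x) \<le> B"
    and u: "u 0 = x" "\<And>t. (u has_vector_derivative f (u t)) (at t)"
    and v: "v 0 = x" "\<And>t. (v has_vector_derivative f (v t)) (at t)"
  shows "u = v"
proof
  fix t :: real
  \<comment> \<open>The sign of \<open>L\<close> is not fixed here, hence the absolute value; the
    added 1 keeps \<open>a\<close> positive when \<open>L\<close> is 0.\<close>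
  define a where "a = 2 * \<bar>L\<bar> + 1"
  have a: "a > 0" "\<bar>L\<bar> \<le> a / 2" by (auto simp: a_def)
  have B: "B \<ge> 0" using bounded[of 0] norm_ge_zero[of "f 0"] by linarith
  have deriv: "((\<lambda>t. u t - v t) has_vector_derivative f (u t) - f (v t)) (at t)" for t
    by (intro derivative_intros u v)
  have "norm (u t - v t) \<le> (2 * B / a) * (1 / 2) ^ k * exp (a * \<bar>t\<bar>)" for k t
  proof (induction k arbitrary: t)
    case 0
    have "norm (f (u t) - f (v t)) \<le> 2 * B * exp (a * \<bar>t\<bar>)" for t
    proof -
      have "norm (f (u t) - f (v t)) \<le> 2 * B"
        using norm_triangle_ineq4[of "f (u t)" "f (v t)"] bounded[of "u t"] bounded[of "v t"] by linarith
      also have "\<dots> \<le> 2 * B * exp (a * \<bar>t\<bar>)" using B a by (simp add: mult_le_cancel_left1)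
      finally show ?thesis .
    qed
    then show ?case
      using norm_antiderivative_le_exp[OF a(1) deriv, of "2 * B" t] u v by simp
  next
    case (Suc k)
    have "norm (f (u t) - f (v t)) \<le> (a / 2 * (2 * B / a * (1 / 2) ^ k)) * exp (a * \<bar>t\<bar>)" for t
    proof -
      have "norm (f (u t) - f (v t)) \<le> a / 2 * norm (u t - v t)"
        using lip[of "u t" "v t"] a(2) by (smt (verit) mult_right_mono norm_ge_zero)
      also have "\<dots> \<le> a / 2 * ((2 * B / a) * (1 / 2) ^ k * exp (a * \<bar>t\<bar>))"
        using Suc a by (intro mult_left_mono) auto
      finally show ?thesis by (simp only: mult.assoc)
    qed
    from norm_antiderivative_le_exp[OF a(1) deriv _ this, of t]
    show ?case using u v a by (simp add: mult_ac)
  qed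
  moreover have "(\<lambda>k. (2 * B / a) * (1 / 2) ^ k * exp (a * \<bar>t\<bar>)) \<longlonglongrightarrow> (2 * B / a) * 0 * exp (a * \<bar>t\<bar>)"
    by (intro tendsto_intros LIMSEQ_power_zero) auto
  ultimately have "norm (u t - v t) \<le> 0"
    by (intro LIMSEQ_le_const[where X = "\<lambda>k. (2 * B / a) * (1 / 2) ^ k * exp (a * \<bar>t\<bar>)"]) auto
  then show "u t = v t" by simp
qed

lemma continuous_antiderivative:
  fixes g :: "real \<Rightarrow> 'a::euclidean_space"
  assumes "continuous_on UNIV g"
  shows "\<exists>G. G 0 = 0 \<and> (\<forall>t. (G has_vector_derivative g t) (at t))"
proof -
  \<comment> \<open>The whole line is taken as one open interval, so that a single antiderivative
    serves negative times too; subtracting \<open>G 0\<close> normalises it.\<close>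
  have "isCont g t" for t using assms by (simp add: continuous_on_eq_continuous_at)
  then obtain G where "\<And>t. (G has_vector_derivative g t) (at t)"
    using einterval_antiderivative[of "-\<infinity>" "\<infinity>" g] by auto
  then show ?thesis
    by (intro exI[of _ "\<lambda>t. G t - G 0"]) (auto intro!: derivative_eq_intros)
qed

text \<open>
  Writing \<open>u t = x + exp (a * \<bar>t\<bar>) *\<^sub>R v t\<close> turns the integral equation into a fixed point equation
  for a bounded continuous \<open>v\<close>, whose right-hand side is a contraction as soon as \<open>a > L\<close>.
\<close>

lemma ode_exists:
  fixes f :: "'a::euclidean_space \<Rightarrow> 'a"
  assumes lip: "\<And>x y. norm (f x - f y) \<le> L * norm (x - y)"
    and bounded: "\<And>x. norm (f x) \<le> B"
  shows "\<exists>u. u 0 = x \<and> (\<forall>t. (u has_vector_derivative f (u t)) (at t))"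
proof -
  define a where "a = 2 * \<bar>L\<bar> + 1"
  have a: "a > 0" "\<bar>L\<bar> \<le> a / 2" by (auto simp: a_def)
  have B: "B \<ge> 0" using bounded[of 0] norm_ge_zero[of "f 0"] by linarith
  have f_cont: "continuous_on UNIV f"
    using lip by (intro lipschitz_on_continuous_on[of "\<bar>L\<bar>"] lipschitz_onI)
      (auto simp: dist_norm intro: order_trans[OF _ mult_right_mono[OF abs_ge_self]])
  define u :: "(real \<Rightarrow>\<^sub>C 'a) \<Rightarrow> real \<Rightarrow> 'a"
    where "u v t = x + exp (a * \<bar>t\<bar>) *\<^sub>R apply_bcontfun v t" for v t
  have u_cont: "continuous_on UNIV (\<lambda>t. f (u v t))" for v
    unfolding u_def by (intro continuous_on_compose2[OF f_cont] continuous_intros) auto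
  then have "\<forall>v. \<exists>G. G 0 = 0 \<and> (\<forall>t. (G has_vector_derivative f (u v t)) (at t))"
    using continuous_antiderivative by blast
  then obtain G where G: "G v 0 = 0" "(G v has_vector_derivative f (u v t)) (at t)" for v t
    by metis
  \<comment> \<open>\<open>Bcontfun\<close> can be evaluated only on bounded continuous functions.
    The weighted antiderivative is one, with bound \<open>B / a\<close>, because \<open>f\<close> is
    bounded.\<close>
  define T where "T v = Bcontfun (\<lambda>t. exp (- (a * \<bar>t\<bar>)) *\<^sub>R G v t)" for v
  have T: "apply_bcontfun (T v) t = exp (- (a * \<bar>t\<bar>)) *\<^sub>R G v t" for v t
  proof -
    have "(\<lambda>t. exp (- (a * \<bar>t\<bar>)) *\<^sub>R G v t) \<in> bcontfun"
    proof (rule bcontfun_normI)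
      have "continuous_on UNIV (G v)"
        using G(2) by (meson continuous_at_imp_continuous_on has_vector_derivative_continuous)
      then show "continuous_on UNIV (\<lambda>t. exp (- (a * \<bar>t\<bar>)) *\<^sub>R G v t)"
        by (intro continuous_intros)
      fix t
      have "norm (f (u v s)) \<le> B * exp (a * \<bar>s\<bar>)" for s
        using bounded[of "u v s"] B a
        by (intro order_trans[OF bounded]) (simp add: mult_le_cancel_left1)
      from norm_antiderivative_le_exp[OF a(1) G(2) G(1) this]
      show "norm (exp (- (a * \<bar>t\<bar>)) *\<^sub>R G v t) \<le> B / a"
        by (simp add: exp_minus field_simps)
    qed
    then show ?thesis by (simp add: T_def Bcontfun_inverse)
  qed
  have contraction: "dist (T v) (T w) \<le> 1 / 2 * dist v w" for v w
  proof (rule dist_bound)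
    fix t
    have deriv: "((\<lambda>t. G v t - G w t) has_vector_derivative f (u v t) - f (u w t)) (at t)" for t
      by (intro derivative_intros G)
    \<comment> \<open>The Lipschitz constant contributes \<open>a / 2\<close> and the integration
      that follows \<open>1 / a\<close>, which together give the factor 1/2.\<close>
    have "norm (f (u v s) - f (u w s)) \<le> (a / 2 * dist v w) * exp (a * \<bar>s\<bar>)" for s
    proof -
      have "norm (u v s - u w s) = exp (a * \<bar>s\<bar>) * dist (apply_bcontfun v s) (apply_bcontfun w s)"
        by (simp add: u_def dist_norm flip: scaleR_diff_right)
      also have "\<dots> \<le> exp (a * \<bar>s\<bar>) * dist v w"
        by (intro mult_left_mono dist_bounded) auto
      finally have "norm (u v s - u w s) \<le> exp (a * \<bar>s\<bar>) * dist v w" .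
      moreover have "norm (f (u v s) - f (u w s)) \<le> a / 2 * norm (u v s - u w s)"
        using lip[of "u v s" "u w s"] a(2) by (smt (verit) mult_right_mono norm_ge_zero)
      moreover have "a / 2 \<ge> 0" using a by simp
      ultimately have "norm (f (u v s) - f (u w s)) \<le> a / 2 * (exp (a * \<bar>s\<bar>) * dist v w)"
        by (meson mult_left_mono order_trans)
      then show ?thesis by (simp only: mult_ac)
    qed
    from norm_antiderivative_le_exp[OF a(1) deriv _ this, of t]
    have "norm (G v t - G w t) \<le> 1 / 2 * dist v w * exp (a * \<bar>t\<bar>)"
      using G(1) a by simp
    then have "exp (- (a * \<bar>t\<bar>)) * norm (G v t - G w t)
        \<le> exp (- (a * \<bar>t\<bar>)) * (1 / 2 * dist v w * exp (a * \<bar>t\<bar>))"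
      by (intro mult_left_mono) auto
    also have "\<dots> = 1 / 2 * dist v w" by (simp add: exp_minus)
    also have "exp (- (a * \<bar>t\<bar>)) * norm (G v t - G w t)
        = dist (apply_bcontfun (T v) t) (apply_bcontfun (T w) t)"
      by (subst dist_norm) (simp add: T flip: scaleR_diff_right)
    finally show "dist (apply_bcontfun (T v) t) (apply_bcontfun (T w) t) \<le> 1 / 2 * dist v w" .
  qed
  obtain v where v: "T v = v"
    using banach_fix_type[of "1 / 2" T] contraction by auto
  \<comment> \<open>At the fixed point the two exponential weights cancel, which leaves the integral
    equation itself.\<close>
  have "u v t = x + G v t" for t
    using T[of v t] by (simp add: v u_def exp_minus)
  then have "u v = (\<lambda>t. x + G v t)" by blast
  then have "u v 0 = x \<and> (\<forall>t. (u v has_vector_derivative f (u v t)) (at t))"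
    using G by (auto intro!: derivative_eq_intros)
  then show ?thesis by blast
qed

section \<open>Flows of vector fields in the smoothness class\<close>

lemma smooth_classD:
  assumes "f \<in> smooth_class L0 L1"
  shows "norm (f x) \<le> L0" "norm (f x - f y) \<le> L1 * norm (x - y)"
proof -
  show "norm (f x) \<le> L0" using assms by (simp add: smooth_class_def)
  obtain Df where "\<And>x. (f has_derivative blinfun_apply (Df x)) (at x)" "\<And>x. norm (Df x) \<le> L1"
    using assms by (auto simp: smooth_class_def)
  then show "norm (f x - f y) \<le> L1 * norm (x - y)"
    by (intro differentiable_bound[of UNIV f "\<lambda>x. blinfun_apply (Df x)"]) (auto simp: norm_blinfun.rep_eq)
qed

text \<open>\<open>flow\<close> is a definite description, so existence and uniqueness must both be
  in place before its characterising properties can be extracted.\<close>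

lemma flow_smooth_class:
  fixes f :: "'a::euclidean_space \<Rightarrow> 'a"
  assumes "f \<in> smooth_class L0 L1"
  shows "flow f x 0 = x" "(flow f x has_vector_derivative f (flow f x t)) (at t)"
proof -
  have "\<exists>!u. u 0 = x \<and> (\<forall>t. (u has_vector_derivative f (u t)) (at t))"
    using ode_exists[OF smooth_classD(2,1)[OF assms]] ode_unique[OF smooth_classD(2,1)[OF assms]]
    by blast
  from theI'[OF this] show "flow f x 0 = x" "(flow f x has_vector_derivative f (flow f x t)) (at t)"
    unfolding flow_def by auto
qed

text \<open>The left-hand side is the integral of \<open>f (flow f x s) - f z\<close> over the time
  step. The speed bound \<open>L0\<close> keeps the trajectory within \<open>L0 * \<Delta>\<close>
  of \<open>x\<close>, and the Lipschitz bound does the rest. The point \<open>z\<close> is separate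
  from \<open>x\<close> because increments are observed at design points but the field is estimated
  at another point.\<close>

lemma flow_increment_bias:
  fixes f :: "'a::euclidean_space \<Rightarrow> 'a"
  assumes f: "f \<in> smooth_class L0 L1" and "L0 \<ge> 0" "L1 \<ge> 0" "\<Delta> > 0"
  shows "norm (flow f x \<Delta> - x - \<Delta> *\<^sub>R f z) \<le> \<Delta> * (L1 * (norm (x - z) + L0 * \<Delta>))"
proof -
  note flow = flow_smooth_class[OF f]
  have cont: "continuous_on {0..t} (flow f x)" for t
    using flow(2) by (meson continuous_at_imp_continuous_on has_vector_derivative_continuous)
  have displacement: "norm (flow f x t - x) \<le> L0 * t" if "t > 0" for t
  proof -
    have "norm (flow f x t - flow f x 0) \<le> L0 * t - L0 * 0"
      by (rule differentiable_bound_general[OF that cont, where f' = "\<lambda>s. f (flow f x s)" and \<phi>' = "\<lambda>_. L0"])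
        (auto intro!: continuous_intros flow derivative_eq_intros smooth_classD(1)[OF f]
           simp flip: has_real_derivative_iff_has_vector_derivative)
    then show ?thesis using flow(1) by simp
  qed
  define D where "D = L1 * (norm (x - z) + L0 * \<Delta>)"
  have "norm ((flow f x \<Delta> - \<Delta> *\<^sub>R f z) - (flow f x 0 - 0 *\<^sub>R f z)) \<le> D * \<Delta> - D * 0"
  proof (rule differentiable_bound_general[where f' = "\<lambda>s. f (flow f x s) - f z" and \<phi>' = "\<lambda>_. D"])
    show "((\<lambda>s. flow f x s - s *\<^sub>R f z) has_vector_derivative f (flow f x s) - f z) (at s)" for s
      by (auto intro!: derivative_eq_intros flow)
    fix s assume s: "0 < s" "s < \<Delta>"
    have "norm (flow f x s - z) \<le> norm (flow f x s - x) + norm (x - z)"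
      by (metis diff_add_cancel add_diff_eq norm_triangle_ineq)
    also have "\<dots> \<le> norm (x - z) + L0 * \<Delta>"
      using displacement[OF s(1)] s \<open>L0 \<ge> 0\<close> by (smt (verit) mult_left_mono)
    finally show "norm (f (flow f x s) - f z) \<le> D"
      unfolding D_def using smooth_classD(2)[OF f] \<open>L1 \<ge> 0\<close> by (meson mult_left_mono order_trans)
  qed (use \<open>\<Delta> > 0\<close> in \<open>auto intro!: continuous_intros cont derivative_eq_intros
         simp flip: has_real_derivative_iff_has_vector_derivative\<close>)
  then show ?thesis using flow(1) by (simp add: D_def algebra_simps)
qed

section \<open>The local constant estimator\<close>

text \<open>Completing the square around the weighted mean \<open>m\<close>: the weighted residuals
  at \<open>m\<close> sum to zero, so the objective at \<open>z\<close> exceeds that at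
  \<open>m\<close> by exactly \<open>W * (norm (m - z))\<^sup>2\<close>. With \<open>W > 0\<close> a
  minimiser must equal \<open>m\<close>.\<close>

lemma local_constant_estimate_eq:
  fixes y :: "nat \<Rightarrow> 'a::real_inner"
  assumes "local_constant_estimate K h J x y v \<theta>"
    and "(\<Sum>j\<in>J. K (norm (x j - v) / h)) > 0"
  shows "\<theta> = (\<Sum>j\<in>J. K (norm (x j - v) / h) *\<^sub>R y j) /\<^sub>R (\<Sum>j\<in>J. K (norm (x j - v) / h))"
proof -
  define w where "w j = K (norm (x j - v) / h)" for j
  define W where "W = sum w J"
  define m where "m = (\<Sum>j\<in>J. w j *\<^sub>R y j) /\<^sub>R W"
  have W: "W > 0" using assms(2) by (simp add: W_def w_def)
  have centred: "(\<Sum>j\<in>J. w j *\<^sub>R (y j - m)) = 0"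
  proof -
    have "(\<Sum>j\<in>J. w j *\<^sub>R (y j - m)) = (\<Sum>j\<in>J. w j *\<^sub>R y j) - W *\<^sub>R m"
      by (simp only: scaleR_diff_right sum_subtractf W_def scaleR_sum_left)
    then show ?thesis using W by (simp add: m_def)
  qed
  have decomp: "(\<Sum>j\<in>J. (norm (y j - z))\<^sup>2 * w j) = (\<Sum>j\<in>J. (norm (y j - m))\<^sup>2 * w j) + W * (norm (m - z))\<^sup>2"
    for z
  proof -
    have "(norm (y j - z))\<^sup>2 * w j
        = (norm (y j - m))\<^sup>2 * w j + w j * (norm (m - z))\<^sup>2 + 2 * ((w j *\<^sub>R (y j - m)) \<bullet> (m - z))" for j
    proof -
      have "(norm (y j - z))\<^sup>2 = (norm (y j - m))\<^sup>2 + (norm (m - z))\<^sup>2 + 2 * ((y j - m) \<bullet> (m - z))"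
        by (simp add: power2_norm_eq_inner inner_diff_left inner_diff_right inner_commute)
      then show ?thesis by (simp only: distrib_left distrib_right inner_scaleR_left mult_ac)
    qed
    then have "(\<Sum>j\<in>J. (norm (y j - z))\<^sup>2 * w j) = (\<Sum>j\<in>J. (norm (y j - m))\<^sup>2 * w j)
        + W * (norm (m - z))\<^sup>2 + 2 * ((\<Sum>j\<in>J. w j *\<^sub>R (y j - m)) \<bullet> (m - z))"
      by (simp add: sum.distrib W_def sum_distrib_right sum_distrib_left inner_sum_left)
    then show ?thesis by (simp add: centred)
  qed
  have "(\<Sum>j\<in>J. (norm (y j - \<theta>))\<^sup>2 * w j) \<le> (\<Sum>j\<in>J. (norm (y j - m))\<^sup>2 * w j)"
    using assms(1) by (auto simp: local_constant_estimate_def is_arg_min_def w_def not_less)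
  then have "W * (norm (m - \<theta>))\<^sup>2 \<le> 0" using decomp[of \<theta>] by simp
  then have "\<theta> = m" using W by (simp add: mult_le_0_iff)
  then show ?thesis by (simp add: m_def W_def w_def)
qed

text \<open>Subtracting \<open>c\<close> commutes with weighted averaging. Asking for the bound only
  at nonzero weights lets design points beyond the bandwidth be ignored.\<close>

lemma norm_weighted_mean_le:
  fixes y :: "'i \<Rightarrow> 'a::real_normed_vector"
  assumes "\<And>j. j \<in> J \<Longrightarrow> 0 \<le> w j" "sum w J > 0"
    and bound: "\<And>j. j \<in> J \<Longrightarrow> w j \<noteq> 0 \<Longrightarrow> norm (y j - c) \<le> D"
  shows "norm ((\<Sum>j\<in>J. w j *\<^sub>R y j) /\<^sub>R sum w J - c) \<le> D"
proof -
  have "(\<Sum>j\<in>J. w j *\<^sub>R y j) /\<^sub>R sum w J - c = (\<Sum>j\<in>J. w j *\<^sub>R (y j - c)) /\<^sub>R sum w J"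
  proof -
    have "(\<Sum>j\<in>J. w j *\<^sub>R (y j - c)) = (\<Sum>j\<in>J. w j *\<^sub>R y j) - sum w J *\<^sub>R c"
      by (simp only: scaleR_diff_right sum_subtractf scaleR_sum_left)
    then show ?thesis using assms(2) by (simp add: scaleR_diff_right)
  qed
  moreover have "norm (\<Sum>j\<in>J. w j *\<^sub>R (y j - c)) \<le> (\<Sum>j\<in>J. w j * D)"
  proof (rule sum_norm_le)
    fix j assume "j \<in> J"
    then show "norm (w j *\<^sub>R (y j - c)) \<le> w j * D"
      using assms(1)[of j] bound[of j] by (cases "w j = 0") (auto intro: mult_left_mono)
  qed
  then have "norm (\<Sum>j\<in>J. w j *\<^sub>R (y j - c)) / sum w J \<le> D"
    using assms(2) by (simp add: pos_divide_le_eq mult.commute[of D] sum_distrib_right)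
  ultimately show ?thesis using assms(2) by (simp add: divide_inverse_commute)
qed

section \<open>Variance of weighted independent noise\<close>

text \<open>Expanding the square gives a double sum of inner products, whose off-diagonal
  expectations vanish by independence and centring.\<close>

lemma (in prob_space) expectation_norm_sum_indep:
  fixes \<epsilon> :: "nat \<Rightarrow> 'a \<Rightarrow> 'b::euclidean_space"
  assumes "finite J" and indep: "indep_vars (\<lambda>_. borel) \<epsilon> J"
    and int: "\<And>j. j \<in> J \<Longrightarrow> integrable M (\<epsilon> j)"
    and mean: "\<And>j. j \<in> J \<Longrightarrow> expectation (\<epsilon> j) = 0"
    and int2: "\<And>j. j \<in> J \<Longrightarrow> integrable M (\<lambda>\<omega>. (norm (\<epsilon> j \<omega>))\<^sup>2)"
  shows "integrable M (\<lambda>\<omega>. (norm (\<Sum>j\<in>J. w j *\<^sub>R \<epsilon> j \<omega>))\<^sup>2)" (is ?int)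
    and "expectation (\<lambda>\<omega>. (norm (\<Sum>j\<in>J. w j *\<^sub>R \<epsilon> j \<omega>))\<^sup>2)
      = (\<Sum>j\<in>J. (w j)\<^sup>2 * expectation (\<lambda>\<omega>. (norm (\<epsilon> j \<omega>))\<^sup>2))" (is ?eq)
proof -
  have cross: "integrable M (\<lambda>\<omega>. \<epsilon> j \<omega> \<bullet> \<epsilon> k \<omega>) \<and> expectation (\<lambda>\<omega>. \<epsilon> j \<omega> \<bullet> \<epsilon> k \<omega>) = 0"
    if jk: "j \<in> J" "k \<in> J" "j \<noteq> k" for j k
  proof -
    \<comment> \<open>The product rule for independent variables is applied to real coordinates;
      summing over \<open>Basis\<close> recovers the inner product.\<close>
    have "integrable M (\<lambda>\<omega>. (\<epsilon> j \<omega> \<bullet> b) * (\<epsilon> k \<omega> \<bullet> b)) \<and> expectation (\<lambda>\<omega>. (\<epsilon> j \<omega> \<bullet> b) * (\<epsilon> k \<omega> \<bullet> b)) = 0"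
      for b
    proof -
      have indep_b: "indep_vars (\<lambda>_. borel) (\<lambda>i \<omega>. \<epsilon> i \<omega> \<bullet> b) {j, k}"
        using jk by (intro indep_vars_compose2[OF indep_vars_subset[OF indep]]) auto
      have int_b: "integrable M (\<lambda>\<omega>. \<epsilon> i \<omega> \<bullet> b)" if "i \<in> {j, k}" for i
        using int that jk by auto
      have "expectation (\<lambda>\<omega>. \<epsilon> j \<omega> \<bullet> b) = 0"
        using int[OF jk(1)] mean[OF jk(1)] by simp
      then show ?thesis
        using indep_vars_lebesgue_integral[OF _ indep_b int_b] indep_vars_integrable[OF _ indep_b int_b] jk(3)
        by simp
    qed
    moreover have "(\<lambda>\<omega>. \<epsilon> j \<omega> \<bullet> \<epsilon> k \<omega>) = (\<lambda>\<omega>. \<Sum>b\<in>Basis. (\<epsilon> j \<omega> \<bullet> b) * (\<epsilon> k \<omega> \<bullet> b))"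
      by (intro ext euclidean_inner)
    ultimately show ?thesis by (simp add: Bochner_Integration.integral_sum)
  qed
  have int_jk: "integrable M (\<lambda>\<omega>. \<epsilon> j \<omega> \<bullet> \<epsilon> k \<omega>)" if "j \<in> J" "k \<in> J" for j k
    using cross[OF that] int2[OF that(1)] by (cases "j = k") (auto simp: power2_norm_eq_inner)
  have square: "(norm (\<Sum>j\<in>J. w j *\<^sub>R \<epsilon> j \<omega>))\<^sup>2 = (\<Sum>j\<in>J. \<Sum>k\<in>J. w j * w k * (\<epsilon> j \<omega> \<bullet> \<epsilon> k \<omega>))" for \<omega>
    unfolding power2_norm_eq_inner
    by (subst inner_sum_left) (simp add: inner_sum_right sum_distrib_left mult_ac)
  show ?int unfolding square using int_jk by auto
  have "expectation (\<lambda>\<omega>. (norm (\<Sum>j\<in>J. w j *\<^sub>R \<epsilon> j \<omega>))\<^sup>2)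
      = (\<Sum>j\<in>J. \<Sum>k\<in>J. w j * w k * expectation (\<lambda>\<omega>. \<epsilon> j \<omega> \<bullet> \<epsilon> k \<omega>))"
    unfolding square using int_jk by (simp add: Bochner_Integration.integral_sum)
  also have "\<dots> = (\<Sum>j\<in>J. \<Sum>k\<in>J. if k = j then (w j)\<^sup>2 * expectation (\<lambda>\<omega>. (norm (\<epsilon> j \<omega>))\<^sup>2) else 0)"
    using cross by (intro sum.cong refl) (auto simp: power2_norm_eq_inner power2_eq_square[of "w _"])
  also have "\<dots> = (\<Sum>j\<in>J. (w j)\<^sup>2 * expectation (\<lambda>\<omega>. (norm (\<epsilon> j \<omega>))\<^sup>2))"
    using \<open>finite J\<close> by simp
  finally show ?eq .
qed

text \<open>In each \<open>(w j)\<^sup>2\<close> one factor is bounded by \<open>C\<close>; the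
  other factors add up to \<open>sum w J\<close> and cancel one power of the squared
  normalisation.\<close>

lemma weighted_noise_variance:
  fixes \<epsilon> :: "nat \<Rightarrow> 'w \<Rightarrow> 'b::euclidean_space"
  assumes noise: "centred_noise M \<sigma> J \<epsilon>" and "finite J"
    and w: "\<And>j. j \<in> J \<Longrightarrow> 0 \<le> w j" "\<And>j. j \<in> J \<Longrightarrow> w j \<le> C" "sum w J > 0"
  shows "integrable M (\<lambda>\<omega>. (norm ((\<Sum>j\<in>J. w j *\<^sub>R \<epsilon> j \<omega>) /\<^sub>R sum w J))\<^sup>2)"
    and "(\<integral>\<omega>. (norm ((\<Sum>j\<in>J. w j *\<^sub>R \<epsilon> j \<omega>) /\<^sub>R sum w J))\<^sup>2 \<partial>M) \<le> \<sigma>\<^sup>2 * C / sum w J"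
proof -
  interpret prob_space M using noise by (simp add: centred_noise_def)
  have int: "integrable M (\<lambda>\<omega>. (norm (\<Sum>j\<in>J. w j *\<^sub>R \<epsilon> j \<omega>))\<^sup>2)"
    and eq: "expectation (\<lambda>\<omega>. (norm (\<Sum>j\<in>J. w j *\<^sub>R \<epsilon> j \<omega>))\<^sup>2)
      = (\<Sum>j\<in>J. (w j)\<^sup>2 * expectation (\<lambda>\<omega>. (norm (\<epsilon> j \<omega>))\<^sup>2))"
    using expectation_norm_sum_indep[of J \<epsilon> w] noise \<open>finite J\<close> by (auto simp: centred_noise_def)
  have square: "(norm ((\<Sum>j\<in>J. w j *\<^sub>R \<epsilon> j \<omega>) /\<^sub>R sum w J))\<^sup>2
      = (norm (\<Sum>j\<in>J. w j *\<^sub>R \<epsilon> j \<omega>))\<^sup>2 / (sum w J)\<^sup>2" for \<omega>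
    by (simp add: power_mult_distrib field_simps)
  show "integrable M (\<lambda>\<omega>. (norm ((\<Sum>j\<in>J. w j *\<^sub>R \<epsilon> j \<omega>) /\<^sub>R sum w J))\<^sup>2)"
    unfolding square using int by simp
  have "(\<Sum>j\<in>J. (w j)\<^sup>2 * expectation (\<lambda>\<omega>. (norm (\<epsilon> j \<omega>))\<^sup>2)) \<le> (\<Sum>j\<in>J. w j * (C * \<sigma>\<^sup>2))"
  proof (rule sum_mono)
    fix j assume j: "j \<in> J"
    then have "expectation (\<lambda>\<omega>. (norm (\<epsilon> j \<omega>))\<^sup>2) \<le> \<sigma>\<^sup>2"
      using noise by (simp add: centred_noise_def)
    then have "w j * expectation (\<lambda>\<omega>. (norm (\<epsilon> j \<omega>))\<^sup>2) \<le> C * \<sigma>\<^sup>2"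
      using w(1,2)[OF j] by (intro mult_mono) auto
    then show "(w j)\<^sup>2 * expectation (\<lambda>\<omega>. (norm (\<epsilon> j \<omega>))\<^sup>2) \<le> w j * (C * \<sigma>\<^sup>2)"
      using w(1)[OF j] by (simp add: power2_eq_square mult.assoc mult_left_mono)
  qed
  also have "\<dots> = sum w J * (C * \<sigma>\<^sup>2)" by (rule sum_distrib_right[symmetric])
  finally have "(\<Sum>j\<in>J. (w j)\<^sup>2 * expectation (\<lambda>\<omega>. (norm (\<epsilon> j \<omega>))\<^sup>2)) / (sum w J)\<^sup>2
      \<le> sum w J * (C * \<sigma>\<^sup>2) / (sum w J)\<^sup>2"
    by (rule divide_right_mono) simp
  then show "(\<integral>\<omega>. (norm ((\<Sum>j\<in>J. w j *\<^sub>R \<epsilon> j \<omega>) /\<^sub>R sum w J))\<^sup>2 \<partial>M) \<le> \<sigma>\<^sup>2 * C / sum w J"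
    unfolding square using eq w(3) by (simp add: power2_eq_square mult_ac)
qed

section \<open>The kernel mass near a point of the cube\<close>

text \<open>A Lipschitz function that is positive at \<open>z0\<close> keeps at least half its value
  on a short interval \<open>[z0, z0 + \<rho>]\<close>. The window has midpoint
  \<open>m = z0 + \<rho> / 2\<close> and half-width \<open>\<delta> = \<rho> / 2\<close>; extending
  it only to the right keeps it inside the domain \<open>{0..}\<close>.\<close>

lemma smoothing_kernelE:
  assumes "smoothing_kernel K"
  obtains C \<kappa> \<delta> m where "C > 0" "\<kappa> > 0" "0 < \<delta>" "\<delta> \<le> 1 / 2" "\<delta> \<le> m" "m \<le> 1"
    "\<And>z. z \<ge> 0 \<Longrightarrow> 0 \<le> K z" "\<And>z. z \<ge> 0 \<Longrightarrow> K z \<le> C" "\<And>z. z > 1 \<Longrightarrow> K z = 0"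
    "\<And>z. \<bar>z - m\<bar> \<le> \<delta> \<Longrightarrow> \<kappa> \<le> K z"
proof -
  obtain L z0 C where L: "L-lipschitz_on {0..} K" and nonneg: "\<And>z. z \<ge> 0 \<Longrightarrow> 0 \<le> K z"
    and z0: "z0 \<ge> 0" "K z0 \<noteq> 0" and C: "C > 0" "\<And>z. z \<ge> 0 \<Longrightarrow> K z \<le> C * indicator {0..1} z"
    using assms by (auto simp: smoothing_kernel_def)
  have le_C: "K z \<le> C" if "z \<ge> 0" for z
    using C that by (smt (verit) indicator_le_1 mult_left_mono mult_cancel_left2)
  have zero: "K z = 0" if "z > 1" for z
    using C(2)[of z] nonneg[of z] that by simp
  define q where "q = K z0"
  have q: "q > 0" using z0 nonneg[of z0] by (simp add: q_def)
  have "L \<ge> 0" using L by (rule lipschitz_on_nonneg)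
  \<comment> \<open>\<open>L + 1\<close> avoids division by zero, and the cap at 1 yields
    \<open>\<delta> \<le> 1 / 2\<close>.\<close>
  define \<rho> where "\<rho> = min 1 (q / (2 * (L + 1)))"
  have \<rho>: "\<rho> > 0" "\<rho> \<le> 1" using q \<open>L \<ge> 0\<close> by (auto simp: \<rho>_def)
  have "L * \<rho> \<le> q / 2"
  proof -
    have "L * \<rho> \<le> (L + 1) * (q / (2 * (L + 1)))"
      using \<open>L \<ge> 0\<close> q \<rho> by (intro mult_mono) (auto simp: \<rho>_def)
    also have "\<dots> = q / 2" using \<open>L \<ge> 0\<close> by (simp add: divide_simps)
    finally show ?thesis .
  qed
  have lower: "q / 2 \<le> K z" if "z0 \<le> z" "z \<le> z0 + \<rho>" for z
  proof -
    have "\<bar>K z - K z0\<bar> \<le> L * \<bar>z - z0\<bar>"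
      using lipschitz_onD[OF L, of z z0] that z0 by (simp add: dist_real_def)
    also have "\<dots> \<le> L * \<rho>" using that \<open>L \<ge> 0\<close> by (intro mult_left_mono) auto
    finally show ?thesis using \<open>L * \<rho> \<le> q / 2\<close> by (simp add: q_def)
  qed
  \<comment> \<open>Otherwise \<open>K\<close> would be positive at a point beyond 1, where it
    vanishes.\<close>
  have "z0 + \<rho> \<le> 1"
    using lower[of "z0 + \<rho>"] zero[of "z0 + \<rho>"] \<rho> q by (cases "z0 + \<rho> \<le> 1") auto
  show ?thesis
  proof
    show "q / 2 \<le> K z" if "\<bar>z - (z0 + \<rho> / 2)\<bar> \<le> \<rho> / 2" for z
      using that by (intro lower) linarith+
  qed (use C q \<rho> z0 nonneg le_C zero \<open>z0 + \<rho> \<le> 1\<close> in auto)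
qed

text \<open>Rounding loses less than one grid point, so more than \<open>n0 * s - 1\<close> remain,
  which is at least half of \<open>n0 * s\<close> because \<open>n0 * s \<ge> 2\<close>.\<close>

lemma card_grid_interval:
  fixes a s :: real
  assumes "0 \<le> a" "a + s \<le> 1" "real n0 * s \<ge> 2"
  shows "real n0 * s / 2 \<le> real (card {k \<in> {1..n0}. a \<le> real k / real n0 \<and> real k / real n0 \<le> a + s})"
proof -
  define lo hi where "lo = nat \<lfloor>real n0 * a\<rfloor>" and "hi = nat \<lfloor>real n0 * (a + s)\<rfloor>"
  have n0: "n0 > 0" using assms by (cases n0) auto
  have s: "s > 0" using assms n0 by (smt (verit) mult_nonneg_nonpos of_nat_0_le_iff)
  have nonneg: "0 \<le> real n0 * a" "0 \<le> real n0 * (a + s)" using assms s by auto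
  have lo: "real lo \<le> real n0 * a" "real n0 * a < real lo + 1"
    using nonneg by (auto simp: lo_def)
  have hi: "real hi \<le> real n0 * (a + s)" "real n0 * (a + s) < real hi + 1"
    using nonneg by (auto simp: hi_def)
  have "real n0 * (a + s) \<le> real n0 * 1" using assms by (intro mult_left_mono) auto
  then have "hi \<le> n0" using hi(1) by simp
  \<comment> \<open>Leaving out \<open>lo\<close> keeps every index at least 1, where the grid
    starts, even if \<open>a = 0\<close>.\<close>
  have "{lo<..hi} \<subseteq> {k \<in> {1..n0}. a \<le> real k / real n0 \<and> real k / real n0 \<le> a + s}"
  proof
    fix k assume "k \<in> {lo<..hi}"
    then have "real lo + 1 \<le> real k" "real k \<le> real hi" by auto
    then show "k \<in> {k \<in> {1..n0}. a \<le> real k / real n0 \<and> real k / real n0 \<le> a + s}"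
      using lo hi \<open>hi \<le> n0\<close> \<open>k \<in> _\<close> n0 by (auto simp: field_simps)
  qed
  then have "card {lo<..hi} \<le> card {k \<in> {1..n0}. a \<le> real k / real n0 \<and> real k / real n0 \<le> a + s}"
    by (intro card_mono) auto
  moreover have "real n0 * s / 2 \<le> real hi - real lo"
    using lo hi assms(3) by (simp add: algebra_simps)
  ultimately show ?thesis by simp
qed

text \<open>
  The kernel may vanish near 0, so the counted grid points lie around a point \<open>p\<close> at distance \<open>m * h\<close>
  from \<open>x0\<close>. It is found on the segment from \<open>x0\<close> to the farthest corner of the cube, whose distance
  from \<open>x0\<close> is at least \<open>sqrt d / 2\<close>.
\<close>

lemma kernel_mass_ge:
  fixes x0 :: "real ^ 'd" and x :: "nat \<Rightarrow> real ^ 'd"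
  defines "d \<equiv> real CARD('d)"
  assumes "finite J" and grid: "x ` J = unit_grid n0" and x0: "x0 \<in> cbox 0 1"
    and h: "0 < h" "h \<le> sqrt d / 2"
    and K_nonneg: "\<And>z. z \<ge> 0 \<Longrightarrow> 0 \<le> K z"
    and K_lower: "\<And>z. \<bar>z - m\<bar> \<le> \<delta> \<Longrightarrow> \<kappa> \<le> K z"
    and "\<kappa> > 0" "0 \<le> m" "m \<le> 1" "0 < \<delta>" "\<delta> \<le> 1 / 2"
    and fine: "real n0 * (\<delta> * h / d) \<ge> 2"
  shows "\<kappa> * (real n0 * (\<delta> * h / d) / 2) ^ CARD('d) \<le> (\<Sum>j\<in>J. K (norm (x j - x0) / h))"
proof -
  \<comment> \<open>Side of the box of counted grid points. The division by \<open>d\<close> pays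
    for bounding the norm by the sum of the \<open>d\<close> coordinates, so that the box lies
    within \<open>\<delta> * h\<close> of \<open>p\<close>.\<close>
  define s where "s = \<delta> * h / d"
  have d: "d \<ge> 1" by (simp add: d_def Suc_le_eq)
  have s: "s > 0" using d h \<open>0 < \<delta>\<close> by (simp add: s_def)
  have "sqrt d \<le> d"
    using d by (simp add: real_le_lsqrt power2_eq_square)
  have "\<delta> * h \<le> 1 / 2 * (d / 2)"
    using h \<open>\<delta> \<le> 1 / 2\<close> \<open>sqrt d \<le> d\<close> \<open>0 < \<delta>\<close> by (intro mult_mono) auto
  then have s_le: "s \<le> 1 / 2" using d by (simp add: s_def field_simps)
  have cube: "0 \<le> x0 $ i" "x0 $ i \<le> 1" for i
    using x0 by (auto simp: mem_box_cart)

  \<comment> \<open>Each coordinate takes the end of \<open>[0, 1]\<close> at distance at least 1/2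
    from that of \<open>x0\<close>.\<close>
  define q :: "real ^ 'd" where "q = (\<chi> i. if x0 $ i \<le> 1 / 2 then 1 else 0)"
  have "sqrt d / 2 = sqrt (\<Sum>i::'d\<in>UNIV. (1 / 2)\<^sup>2)"
    by (simp add: d_def real_sqrt_divide power_divide)
  also have "\<dots> \<le> norm (q - x0)"
    unfolding norm_vec_def L2_set_def
  proof (intro real_sqrt_le_mono sum_mono)
    fix i
    have "\<bar>1 / 2\<bar> \<le> \<bar>(q - x0) $ i\<bar>" by (simp add: q_def)
    then show "(1 / 2)\<^sup>2 \<le> (norm ((q - x0) $ i))\<^sup>2"
      by (metis abs_le_square_iff real_norm_def power2_abs)
  qed
  finally have far: "h \<le> norm (q - x0)" using h by simp

  define t where "t = m * h / norm (q - x0)"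
  have "m * h \<le> norm (q - x0)"
    using far h mult_right_mono[OF \<open>m \<le> 1\<close>, of h] by linarith
  moreover have "norm (q - x0) > 0" using far h by linarith
  ultimately have t: "0 \<le> t" "t \<le> 1" using h \<open>0 \<le> m\<close> by (simp_all add: t_def)
  define p where "p = x0 + t *\<^sub>R (q - x0)"
  have p_dist: "norm (p - x0) = m * h"
    using \<open>norm (q - x0) > 0\<close> h \<open>0 \<le> m\<close> by (auto simp: p_def t_def)
  have p_cube: "0 \<le> p $ i" "p $ i \<le> 1" for i
  proof -
    have "p $ i = (1 - t) * x0 $ i + t * q $ i" by (simp add: p_def algebra_simps)
    moreover have "0 \<le> q $ i" "q $ i \<le> 1" by (auto simp: q_def)
    ultimately show "0 \<le> p $ i" "p $ i \<le> 1"
      using cube[of i] t convex_bound_le[of "x0 $ i" 1 "q $ i" "1 - t" t] by auto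
  qed

  \<comment> \<open>An interval of length \<open>s\<close> with \<open>p $ i\<close> as an endpoint,
    laid towards the middle of \<open>[0, 1]\<close> so that it does not leave the cube; this uses
    \<open>s \<le> 1 / 2\<close>.\<close>
  define a where "a i = (if p $ i \<le> 1 / 2 then p $ i else p $ i - s)" for i
  have a: "0 \<le> a i" "a i + s \<le> 1" "a i \<le> p $ i" "p $ i \<le> a i + s" for i
    using p_cube[of i] s s_le by (auto simp: a_def)
  define I where "I i = {k \<in> {1..n0}. a i \<le> real k / real n0 \<and> real k / real n0 \<le> a i + s}" for i
  define \<Phi> :: "('d \<Rightarrow> nat) \<Rightarrow> real ^ 'd" where "\<Phi> g = (\<chi> i. real (g i) / real n0)" for g
  define G where "G = \<Phi> ` (\<Pi>\<^sub>E i\<in>UNIV. I i)"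
  have fine': "2 \<le> real n0 * s" using fine by (simp only: s_def)
  then have n0: "n0 > 0" by (cases n0) auto
  have "inj \<Phi>"
    using n0 by (auto simp: inj_def \<Phi>_def vec_eq_iff)
  then have "real (card G) = (\<Prod>i\<in>UNIV. real (card (I i)))"
    by (simp add: G_def card_image inj_on_subset card_PiE)
  moreover have "(\<Prod>i::'d\<in>UNIV. real n0 * s / 2) \<le> (\<Prod>i\<in>UNIV. real (card (I i)))"
    unfolding I_def using fine' by (intro prod_mono conjI card_grid_interval a fine') auto
  ultimately have card_G: "(real n0 * s / 2) ^ CARD('d) \<le> real (card G)" by simp

  have near: "\<kappa> \<le> K (norm (y - x0) / h)" if "y \<in> G" for y
  proof -
    obtain g where g: "y = \<Phi> g" "\<And>i. g i \<in> I i" using \<open>y \<in> G\<close> by (auto simp: G_def)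
    have "norm (y - p) \<le> (\<Sum>i\<in>UNIV. \<bar>(y - p) $ i\<bar>)" by (rule norm_le_l1_cart)
    also have "\<dots> \<le> (\<Sum>i::'d\<in>UNIV. s)"
    proof (rule sum_mono)
      fix i
      have "a i \<le> y $ i" "y $ i \<le> a i + s" using g by (auto simp: I_def \<Phi>_def)
      then show "\<bar>(y - p) $ i\<bar> \<le> s" using a(3,4)[of i] by simp
    qed
    also have "\<dots> = \<delta> * h" using d by (simp add: s_def d_def)
    finally have "norm (y - p) \<le> \<delta> * h" .
    \<comment> \<open>The reverse triangle inequality moves the scaled distance of \<open>y\<close>
      from \<open>x0\<close> into the window where \<open>K\<close> is at least
      \<open>\<kappa>\<close>.\<close>
    then have "\<bar>norm (y - x0) - m * h\<bar> \<le> \<delta> * h"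
      using norm_triangle_ineq3[of "y - x0" "p - x0"] p_dist by simp
    then have "\<bar>norm (y - x0) / h - m\<bar> \<le> \<delta>"
      using h by (simp add: abs_le_iff field_simps)
    then show ?thesis by (rule K_lower)
  qed
  have "G \<subseteq> unit_grid n0"
    by (fastforce simp: G_def unit_grid_def \<Phi>_def I_def)
  \<comment> \<open>The design is known only through its image, so each grid point is charged to at
    least one index.\<close>
  then have G_image: "G \<subseteq> x ` {j \<in> J. x j \<in> G}" using grid by auto
  have "card G \<le> card {j \<in> J. x j \<in> G}"
    using \<open>finite J\<close> surj_card_le[OF _ G_image] by simp
  then have "(real n0 * s / 2) ^ CARD('d) \<le> real (card {j \<in> J. x j \<in> G})"
    using card_G by linarith
  then have "\<kappa> * (real n0 * s / 2) ^ CARD('d) \<le> \<kappa> * real (card {j \<in> J. x j \<in> G})"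
    using \<open>\<kappa> > 0\<close> by simp
  also have "\<dots> = (\<Sum>j\<in>{j \<in> J. x j \<in> G}. \<kappa>)" by simp
  also have "\<dots> \<le> (\<Sum>j\<in>{j \<in> J. x j \<in> G}. K (norm (x j - x0) / h))"
    by (intro sum_mono near) auto
  also have "\<dots> \<le> (\<Sum>j\<in>J. K (norm (x j - x0) / h))"
    using \<open>finite J\<close> h by (intro sum_mono2) (auto intro!: K_nonneg)
  finally show ?thesis by (simp add: s_def)
qed

section \<open>Mean squared error at a fixed sample size\<close>

text \<open>The estimate splits into the weighted mean \<open>B\<close> of the noiseless increments
  and the weighted noise \<open>N\<close>. The inequality
  \<open>(a + b)\<^sup>2 \<le> 2 * a\<^sup>2 + 2 * b\<^sup>2\<close> separates bias from variance,
  and dividing by \<open>\<Delta>\<close> inflates only the noise, because the bias of the increment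
  is itself proportional to \<open>\<Delta>\<close>.\<close>

lemma local_constant_mse_le:
  fixes f :: "'a::euclidean_space \<Rightarrow> 'a" and x :: "nat \<Rightarrow> 'a" and z :: 'a and J :: "nat set"
    and K :: "real \<Rightarrow> real" and h :: real
  defines "S \<equiv> \<Sum>j\<in>J. K (norm (x j - z) / h)"
  assumes f: "f \<in> smooth_class L0 L1" and L: "L0 \<ge> 0" "L1 \<ge> 0"
    and noise: "centred_noise M \<sigma> J \<epsilon>" and "finite J"
    and "\<Delta> > 0" "h > 0"
    and obs: "\<And>j \<omega>. j \<in> J \<Longrightarrow> \<omega> \<in> space M \<Longrightarrow> Y j \<omega> = flow f (x j) \<Delta> + \<epsilon> j \<omega>"
    and K: "\<And>s. s \<ge> 0 \<Longrightarrow> 0 \<le> K s" "\<And>s. s \<ge> 0 \<Longrightarrow> K s \<le> C" "\<And>s. s > 1 \<Longrightarrow> K s = 0"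
    and est: "\<And>\<omega>. \<omega> \<in> space M \<Longrightarrow> local_constant_estimate K h J x (\<lambda>j. Y j \<omega> - x j) z (\<iota> \<omega>)"
    and S: "S > 0"
  shows "(\<integral>\<^sup>+ \<omega>. ennreal ((norm (\<iota> \<omega> /\<^sub>R \<Delta> - f z))\<^sup>2) \<partial>M)
    \<le> ennreal (2 * (L1 * (h + L0 * \<Delta>))\<^sup>2 + 2 * (\<sigma>\<^sup>2 * C / S) / \<Delta>\<^sup>2)"
proof -
  interpret prob_space M using noise by (simp add: centred_noise_def)
  define w where "w j = K (norm (x j - z) / h)" for j
  have S_w: "S = sum w J" by (simp add: S_def w_def)
  have w: "0 \<le> w j" "w j \<le> C" for j using K \<open>h > 0\<close> by (auto simp: w_def)
  define D where "D = L1 * (h + L0 * \<Delta>)"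
  define B where "B = (\<Sum>j\<in>J. w j *\<^sub>R (flow f (x j) \<Delta> - x j)) /\<^sub>R S"
  define N where "N \<omega> = (\<Sum>j\<in>J. w j *\<^sub>R \<epsilon> j \<omega>) /\<^sub>R S" for \<omega>
  have bias: "norm (B - \<Delta> *\<^sub>R f z) \<le> \<Delta> * D"
    unfolding B_def S_w
  proof (rule norm_weighted_mean_le)
    fix j assume "w j \<noteq> 0"
    then have "norm (x j - z) \<le> h"
      using K(3)[of "norm (x j - z) / h"] \<open>h > 0\<close> by (force simp: w_def not_less)
    then have "\<Delta> * (L1 * (norm (x j - z) + L0 * \<Delta>)) \<le> \<Delta> * D"
      unfolding D_def using L \<open>\<Delta> > 0\<close> by (intro mult_left_mono) auto
    then show "norm (flow f (x j) \<Delta> - x j - \<Delta> *\<^sub>R f z) \<le> \<Delta> * D"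
      using flow_increment_bias[OF f L \<open>\<Delta> > 0\<close>, of "x j" z] by linarith
  qed (use w S in \<open>auto simp: S_w\<close>)
  have pointwise: "(norm (\<iota> \<omega> /\<^sub>R \<Delta> - f z))\<^sup>2 \<le> 2 * D\<^sup>2 + 2 / \<Delta>\<^sup>2 * (norm (N \<omega>))\<^sup>2" if "\<omega> \<in> space M" for \<omega>
  proof -
    have "\<iota> \<omega> = (\<Sum>j\<in>J. w j *\<^sub>R (Y j \<omega> - x j)) /\<^sub>R S"
      using local_constant_estimate_eq[OF est[OF that]] S by (simp add: S_def w_def)
    also have "(\<Sum>j\<in>J. w j *\<^sub>R (Y j \<omega> - x j))
        = (\<Sum>j\<in>J. w j *\<^sub>R (flow f (x j) \<Delta> - x j)) + (\<Sum>j\<in>J. w j *\<^sub>R \<epsilon> j \<omega>)"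
      unfolding sum.distrib[symmetric] using obs that by (intro sum.cong) (auto simp: algebra_simps)
    finally have "\<iota> \<omega> /\<^sub>R \<Delta> - f z = (B - \<Delta> *\<^sub>R f z) /\<^sub>R \<Delta> + N \<omega> /\<^sub>R \<Delta>"
      using \<open>\<Delta> > 0\<close> by (simp add: B_def N_def scaleR_add_right scaleR_diff_right)
    then have "norm (\<iota> \<omega> /\<^sub>R \<Delta> - f z) \<le> norm ((B - \<Delta> *\<^sub>R f z) /\<^sub>R \<Delta>) + norm (N \<omega> /\<^sub>R \<Delta>)"
      by (metis norm_triangle_ineq)
    also have "\<dots> \<le> D + norm (N \<omega>) / \<Delta>"
    proof -
      have "norm ((B - \<Delta> *\<^sub>R f z) /\<^sub>R \<Delta>) = norm (B - \<Delta> *\<^sub>R f z) / \<Delta>"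
        and "norm (N \<omega> /\<^sub>R \<Delta>) = norm (N \<omega>) / \<Delta>"
        using \<open>\<Delta> > 0\<close> by (simp_all only: norm_scaleR abs_inverse abs_of_pos divide_inverse_commute)
      then show ?thesis using bias \<open>\<Delta> > 0\<close> by (simp add: pos_divide_le_eq mult.commute)
    qed
    finally have "(norm (\<iota> \<omega> /\<^sub>R \<Delta> - f z))\<^sup>2 \<le> (D + norm (N \<omega>) / \<Delta>)\<^sup>2"
      by (intro power_mono) auto
    also have "\<dots> \<le> 2 * D\<^sup>2 + 2 * (norm (N \<omega>) / \<Delta>)\<^sup>2"
      using sum_squares_bound[of D "norm (N \<omega>) / \<Delta>"] by (simp add: power2_sum)
    finally show ?thesis by (simp add: power_divide)
  qed
  have int: "integrable M (\<lambda>\<omega>. (norm (N \<omega>))\<^sup>2)"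
    and var: "expectation (\<lambda>\<omega>. (norm (N \<omega>))\<^sup>2) \<le> \<sigma>\<^sup>2 * C / S"
    using weighted_noise_variance[OF noise \<open>finite J\<close>, of w C] w S by (auto simp: N_def S_w)
  \<comment> \<open>The pointwise bound is an integrable function of the noise, so the nonnegative
    integral turns into an ordinary expectation only after the bound is applied.\<close>
  have "(\<integral>\<^sup>+ \<omega>. ennreal ((norm (\<iota> \<omega> /\<^sub>R \<Delta> - f z))\<^sup>2) \<partial>M)
      \<le> (\<integral>\<^sup>+ \<omega>. ennreal (2 * D\<^sup>2 + 2 / \<Delta>\<^sup>2 * (norm (N \<omega>))\<^sup>2) \<partial>M)"
    by (intro nn_integral_mono ennreal_leI pointwise)
  also have "\<dots> = ennreal (expectation (\<lambda>\<omega>. 2 * D\<^sup>2 + 2 / \<Delta>\<^sup>2 * (norm (N \<omega>))\<^sup>2))"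
    using int by (intro nn_integral_eq_integral) auto
  also have "expectation (\<lambda>\<omega>. 2 * D\<^sup>2 + 2 / \<Delta>\<^sup>2 * (norm (N \<omega>))\<^sup>2)
      = 2 * D\<^sup>2 + 2 / \<Delta>\<^sup>2 * expectation (\<lambda>\<omega>. (norm (N \<omega>))\<^sup>2)"
    using int by (simp add: prob_space)
  also have "ennreal \<dots> \<le> ennreal (2 * D\<^sup>2 + 2 / \<Delta>\<^sup>2 * (\<sigma>\<^sup>2 * C / S))"
    using var \<open>\<Delta> > 0\<close> by (intro ennreal_leI add_left_mono mult_left_mono) auto
  finally show ?thesis by (simp add: D_def mult.commute)
qed

section \<open>Asymptotic comparison\<close>

text \<open>A real number strictly between the limsup and infinity eventually bounds the quotient.
  The sign conditions turn the \<open>ennreal\<close> quotient into the real one.\<close>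

lemma asymp_leE:
  assumes "asymp_le (\<lambda>n. ennreal (a n)) (\<lambda>n. ennreal (b n))"
    and pos: "\<forall>\<^sub>F n in sequentially. 0 \<le> a n \<and> 0 < b n"
  obtains C where "C > 0" "\<forall>\<^sub>F n in sequentially. a n \<le> C * b n"
proof -
  obtain y where y: "limsup (\<lambda>n. ennreal (a n) / ennreal (b n)) < y" "y < \<infinity>"
    using assms(1) dense by (auto simp: asymp_le_def)
  then obtain c where c: "c \<ge> 0" "y = ennreal c" by (cases y) auto
  \<comment> \<open>\<open>c\<close> is only known to be nonnegative; \<open>c + 1\<close> gives a
    strictly positive constant.\<close>
  have "\<forall>\<^sub>F n in sequentially. a n \<le> (c + 1) * b n"
    using Limsup_lessD[OF y(1)] pos
  proof eventually_elim
    case (elim n)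
    then have "ennreal (a n / b n) < ennreal c" using c by (simp add: divide_ennreal)
    then have "a n / b n < c" using c elim by (simp add: ennreal_less_iff)
    then show ?case using elim by (simp add: field_simps)
  qed
  with c show ?thesis by (intro that[of "c + 1"]) auto
qed

lemma asymp_leI:
  assumes "\<forall>\<^sub>F n in sequentially. a n \<le> ennreal (C * b n)"
    and "\<forall>\<^sub>F n in sequentially. 0 < b n" and "C \<ge> 0"
  shows "asymp_le a (\<lambda>n. ennreal (b n))"
proof -
  have "\<forall>\<^sub>F n in sequentially. a n / ennreal (b n) \<le> ennreal C"
    using assms(1,2)
  proof eventually_elim
    case (elim n)
    then have "a n / ennreal (b n) \<le> ennreal (C * b n) / ennreal (b n)"
      by (intro divide_right_mono_ennreal)
    also have "\<dots> = ennreal C" using elim \<open>C \<ge> 0\<close> by (simp add: divide_ennreal)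
    finally show ?case .
  qed
  then have "limsup (\<lambda>n. a n / ennreal (b n)) \<le> ennreal C" by (rule Limsup_bounded)
  then show ?thesis unfolding asymp_le_def by (rule order_le_less_trans) simp
qed

section \<open>Rate of convergence\<close>

text \<open>Sequences are indexed by the number of grid points per axis. The assumption
  \<open>bandwidth_small\<close> matters if \<open>\<Delta>t\<close> shrinks so fast that
  \<open>(\<Delta>t)\<^sup>2 * n\<close> does not tend to infinity: with a large bandwidth and a
  kernel vanishing near 0 all weights could be zero, and every \<open>\<theta>\<close> would be a
  minimiser.\<close>

theorem theorem3p2:
  fixes K :: "real \<Rightarrow> real"
    and L0 L1 \<sigma> :: real
    and M :: "nat \<Rightarrow> 'w measure"
    and f :: "nat \<Rightarrow> real ^ 'd \<Rightarrow> real ^ 'd"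
    and x :: "nat \<Rightarrow> nat \<Rightarrow> real ^ 'd"
    and \<epsilon> :: "nat \<Rightarrow> nat \<Rightarrow> 'w \<Rightarrow> real ^ 'd"
    and Y :: "nat \<Rightarrow> nat \<Rightarrow> 'w \<Rightarrow> real ^ 'd"
    and \<Delta>t h :: "nat \<Rightarrow> real"
    and \<iota>_hat f_hat :: "nat \<Rightarrow> 'w \<Rightarrow> real ^ 'd \<Rightarrow> real ^ 'd"
    and x0 :: "nat \<Rightarrow> real ^ 'd"
    and d :: nat and n :: "nat \<Rightarrow> nat"
  defines "d \<equiv> CARD('d)"
    and "n \<equiv> \<lambda>n0. n0 ^ d"
  assumes L_pos: "L0 > 0" "L1 > 0"
    and sigma_nonneg: "\<sigma> \<ge> 0"
    and kernel: "smoothing_kernel K"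
    and f_smooth: "\<And>n0. n0 \<ge> 1 \<Longrightarrow> f n0 \<in> smooth_class L0 L1"
    and grid: "\<And>n0. n0 \<ge> 1 \<Longrightarrow> x n0 ` {1..n n0} = unit_grid n0"
    and noise: "\<And>n0. n0 \<ge> 1 \<Longrightarrow> centred_noise (M n0) \<sigma> {1..n n0} (\<epsilon> n0)"
    and step_pos: "\<And>n0. n0 \<ge> 1 \<Longrightarrow> \<Delta>t n0 > 0"
    and observations: "\<And>n0 j \<omega>. n0 \<ge> 1 \<Longrightarrow> j \<in> {1..n n0} \<Longrightarrow> \<omega> \<in> space (M n0) \<Longrightarrow>
      Y n0 j \<omega> = flow (f n0) (x n0 j) (\<Delta>t n0) + \<epsilon> n0 j \<omega>"
    and bandwidth_pos: "\<And>n0. n0 \<ge> 1 \<Longrightarrow> h n0 > 0"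
    and bandwidth_order: "same_order (\<lambda>n0. ennreal (h n0))
      (\<lambda>n0. ennreal (((\<Delta>t n0)\<^sup>2 * real (n n0)) powr (- 1 / (2 + real d))))"
    and bandwidth_small: "\<forall>\<^sub>F n0 in sequentially. h n0 \<le> sqrt (real d) / 2"
    and \<iota>_hat: "\<And>n0 \<omega> v. n0 \<ge> 1 \<Longrightarrow> \<omega> \<in> space (M n0) \<Longrightarrow>
      local_constant_estimate K (h n0) {1..n n0} (x n0) (\<lambda>j. Y n0 j \<omega> - x n0 j) v (\<iota>_hat n0 \<omega> v)"
    and f_hat: "\<And>n0 \<omega> v. n0 \<ge> 1 \<Longrightarrow> \<omega> \<in> space (M n0) \<Longrightarrow>
      f_hat n0 \<omega> v = \<iota>_hat n0 \<omega> v /\<^sub>R \<Delta>t n0"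
    and step_bounded: "asymp_le (\<lambda>n0. ennreal (\<Delta>t n0)) (\<lambda>_. 1)"
    and x0: "\<And>n0. n0 \<ge> 1 \<Longrightarrow> x0 n0 \<in> cbox 0 1"
  shows "asymp_le
    (\<lambda>n0. \<integral>\<^sup>+ \<omega>. ennreal ((norm (f_hat n0 \<omega> (x0 n0) - f n0 (x0 n0)))\<^sup>2) \<partial>M n0)
    (\<lambda>n0. ennreal (((\<Delta>t n0)\<^sup>2 * real (n n0)) powr (- 2 / (2 + real d)) + (\<Delta>t n0)\<^sup>2))"
proof -
  have d: "d \<ge> 1" by (simp add: d_def Suc_le_eq)
  have n_pos: "real (n k) > 0" if "k \<ge> 1" for k using that by (simp add: n_def)
  define r where "r k = ((\<Delta>t k)\<^sup>2 * real (n k)) powr (- 1 / (2 + real d))" for k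
  have r_pos: "r k > 0" if "k \<ge> 1" for k
    using step_pos[OF that] n_pos[OF that] by (simp add: r_def)
  have r_square: "((\<Delta>t k)\<^sup>2 * real (n k)) powr (- 2 / (2 + real d)) = (r k)\<^sup>2" for k
    by (simp add: r_def power2_eq_square flip: powr_add)
  \<comment> \<open>The balance behind the rate: the squared bandwidth order
    \<open>(r k)\<^sup>2\<close> equals the variance order
    \<open>1 / ((\<Delta>t k)\<^sup>2 * n k * r k ^ d)\<close>.\<close>
  have r_power: "(\<Delta>t k)\<^sup>2 * real (n k) * (r k)\<^sup>2 * r k ^ d = 1" if "k \<ge> 1" for k
  proof -
    define Q where "Q = (\<Delta>t k)\<^sup>2 * real (n k)"
    have "Q > 0" using step_pos[OF that] n_pos[OF that] by (simp add: Q_def)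
    have "(r k)\<^sup>2 * r k ^ d = r k powr (2 + real d)"
      using r_pos[OF that] by (simp add: powr_add powr_realpow)
    also have "\<dots> = Q powr (- 1 / (2 + real d) * (2 + real d))"
      unfolding r_def Q_def[symmetric] by (rule powr_powr)
    also have "- 1 / (2 + real d) * (2 + real d) = - 1" by simp
    also have "Q powr - 1 = 1 / Q" using \<open>Q > 0\<close> by (simp add: powr_minus divide_inverse)
    finally show ?thesis using \<open>Q > 0\<close> by (simp add: mult.assoc flip: Q_def)
  qed
  have large: "\<forall>\<^sub>F k in sequentially. k \<ge> 1" by (rule eventually_ge_at_top)

  have h_r: "asymp_le (\<lambda>k. ennreal (h k)) (\<lambda>k. ennreal (r k))"
    and r_h: "asymp_le (\<lambda>k. ennreal (r k)) (\<lambda>k. ennreal (h k))"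
    using bandwidth_order by (simp_all only: same_order_def r_def)
  have "\<forall>\<^sub>F k in sequentially. 0 \<le> h k \<and> 0 < r k"
    using large by eventually_elim (simp add: bandwidth_pos r_pos less_imp_le)
  then obtain C1 where C1: "C1 > 0" "\<forall>\<^sub>F k in sequentially. h k \<le> C1 * r k"
    by (rule asymp_leE[OF h_r])
  have "\<forall>\<^sub>F k in sequentially. 0 \<le> r k \<and> 0 < h k"
    using large by eventually_elim (simp add: bandwidth_pos r_pos less_imp_le)
  then obtain C2 where C2: "C2 > 0" "\<forall>\<^sub>F k in sequentially. r k \<le> C2 * h k"
    by (rule asymp_leE[OF r_h])
  have step: "asymp_le (\<lambda>k. ennreal (\<Delta>t k)) (\<lambda>_. ennreal 1)"
    using step_bounded by simp
  have "\<forall>\<^sub>F k in sequentially. 0 \<le> \<Delta>t k \<and> 0 < (1 :: real)"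
    using large by eventually_elim (simp add: step_pos less_imp_le)
  then obtain T where T: "T > 0" "\<forall>\<^sub>F k in sequentially. \<Delta>t k \<le> T * 1"
    by (rule asymp_leE[OF step])
  obtain C \<kappa> \<delta> m where C: "C > 0" and \<kappa>: "\<kappa> > 0" and \<delta>: "0 < \<delta>" "\<delta> \<le> 1 / 2" "\<delta> \<le> m" and m: "m \<le> 1"
    and K: "\<And>z. z \<ge> 0 \<Longrightarrow> 0 \<le> K z" "\<And>z. z \<ge> 0 \<Longrightarrow> K z \<le> C" "\<And>z. z > 1 \<Longrightarrow> K z = 0"
    and K_lower: "\<And>z. \<bar>z - m\<bar> \<le> \<delta> \<Longrightarrow> \<kappa> \<le> K z"
    by (rule smoothing_kernelE[OF kernel]) blast

  \<comment> \<open>The bandwidth is of larger order than the mesh \<open>1 / k\<close> because the time steps are bounded.\<close>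
  have fine: "\<forall>\<^sub>F k in sequentially. 2 \<le> real k * (\<delta> * h k / d)"
  proof -
    define e where "e = 1 / (2 + real d)"
    \<comment> \<open>Multiplying \<open>k\<close> by \<open>(k ^ d) powr (- e)\<close> leaves the
      positive exponent \<open>2 * e\<close>, so the bandwidth measured in mesh widths
      diverges.\<close>
    have e: "e > 0" "1 - real d * e = 2 * e" by (auto simp: e_def field_simps)
    define c where "c = \<delta> / (d * C2) * (T\<^sup>2) powr (- e)"
    have c: "c > 0" using \<delta> d C2 T by (simp add: c_def)
    have "filterlim (\<lambda>k. c * real k powr (2 * e)) at_top sequentially"
      using c e(1) by real_asymp
    then have "\<forall>\<^sub>F k in sequentially. 2 \<le> c * real k powr (2 * e)"
      by (auto simp: filterlim_at_top)
    then show ?thesis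
      using C2(2) T(2) large
    proof eventually_elim
      case (elim k)
      \<comment> \<open>The negative exponent turns the upper bound \<open>T\<close> on the time
        step into a lower bound on \<open>r k\<close>.\<close>
      have "(T\<^sup>2 * real (n k)) powr (- e) \<le> r k"
        unfolding r_def e_def using elim step_pos[of k] n_pos[of k] T
        by (auto intro!: powr_mono2' mult_right_mono power_mono)
      also have "(T\<^sup>2 * real (n k)) powr (- e) = (T\<^sup>2) powr (- e) * real k powr (- (real d * e))"
      proof -
        have "real (n k) = real k powr real d"
          using elim by (simp add: n_def powr_realpow)
        then show ?thesis by (simp add: powr_mult powr_powr)
      qed
      finally have "(T\<^sup>2) powr (- e) * real k powr (- (real d * e)) \<le> C2 * h k"
        using elim by linarith
      then have "real k * (\<delta> / (d * C2)) * ((T\<^sup>2) powr (- e) * real k powr (- (real d * e)))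
          \<le> real k * (\<delta> / (d * C2)) * (C2 * h k)"
        using \<delta> d C2 by (intro mult_left_mono) auto
      moreover have "real k * real k powr (- (real d * e)) = real k powr (2 * e)"
        using powr_mult_base[of "real k" "- (real d * e)"] e(2) by simp
      then have "c * real k powr (2 * e)
          = real k * (\<delta> / (d * C2)) * ((T\<^sup>2) powr (- e) * real k powr (- (real d * e)))"
        by (simp add: c_def)
      moreover have "real k * (\<delta> / (d * C2)) * (C2 * h k) = real k * (\<delta> * h k / d)"
        using C2 by simp
      ultimately show ?case using elim by linarith
    qed
  qed

  \<comment> \<open>The constant left in the kernel mass bound after \<open>h k\<close> is replaced
    by its lower bound \<open>r k / C2\<close>.\<close>
  define A where "A = \<kappa> * (\<delta> / (2 * d * C2)) ^ d"
  have A: "A > 0" using \<kappa> \<delta> d C2 by (simp add: A_def)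
  \<comment> \<open>Each 4 arises from splitting a square twice: bias against noise, then
    \<open>h\<close> against \<open>L0 * \<Delta>t\<close>.\<close>
  define B where "B = 4 * L1\<^sup>2 * C1\<^sup>2 + 4 * L1\<^sup>2 * L0\<^sup>2 + 2 * \<sigma>\<^sup>2 * C / A"
  have "\<forall>\<^sub>F k in sequentially.
    (\<integral>\<^sup>+ \<omega>. ennreal ((norm (f_hat k \<omega> (x0 k) - f k (x0 k)))\<^sup>2) \<partial>M k)
      \<le> ennreal (B * ((r k)\<^sup>2 + (\<Delta>t k)\<^sup>2))"
    using C1(2) C2(2) bandwidth_small fine large
  proof eventually_elim
    case (elim k)
    note k = elim(5)
    define S where "S = (\<Sum>j\<in>{1..n k}. K (norm (x k j - x0 k) / h k))"
    have h: "h k > 0" using bandwidth_pos k .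
    have \<Delta>: "\<Delta>t k > 0" using step_pos k .
    have "\<kappa> * (real k * (\<delta> * h k / d) / 2) ^ d \<le> S"
      unfolding S_def d_def
      by (rule kernel_mass_ge[OF _ grid[OF k] x0[OF k] h _ K(1) K_lower \<kappa> _ m \<delta>(1,2)])
        (use elim \<delta> in \<open>auto simp: d_def\<close>)
    moreover have "\<kappa> * (real k * (\<delta> * (r k / C2) / d) / 2) ^ d \<le> \<kappa> * (real k * (\<delta> * h k / d) / 2) ^ d"
      using elim(2) \<kappa> \<delta> d C2 r_pos[OF k] k
      by (intro mult_left_mono power_mono divide_right_mono) (auto simp: divide_le_eq mult.commute)
    moreover have "\<kappa> * (real k * (\<delta> * (r k / C2) / d) / 2) ^ d = A * (real (n k) * r k ^ d)"
      by (simp add: A_def n_def power_mult_distrib power_divide mult_ac)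
    ultimately have S: "A * (real (n k) * r k ^ d) \<le> S" by linarith
    have "A * (real (n k) * r k ^ d) > 0" using A n_pos[OF k] r_pos[OF k] by simp
    then have S_pos: "S > 0" using S by linarith
    \<comment> \<open>Inserting the balance equation as a factor 1 turns the mass bound into
      \<open>1 / (S * (\<Delta>t k)\<^sup>2) \<le> (r k)\<^sup>2 / A\<close>, the variance at the
      desired rate.\<close>
    have "A = A * ((\<Delta>t k)\<^sup>2 * real (n k) * (r k)\<^sup>2 * r k ^ d)"
      using r_power[OF k] by simp
    also have "\<dots> = A * (real (n k) * r k ^ d) * ((\<Delta>t k)\<^sup>2 * (r k)\<^sup>2)"
      by (simp only: mult_ac)
    also have "\<dots> \<le> S * ((\<Delta>t k)\<^sup>2 * (r k)\<^sup>2)"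
      using S by (intro mult_right_mono) auto
    finally have mass: "A \<le> S * (\<Delta>t k)\<^sup>2 * (r k)\<^sup>2" by (simp only: mult.assoc)
    have "2 * (\<sigma>\<^sup>2 * C / S) / (\<Delta>t k)\<^sup>2 = 2 * \<sigma>\<^sup>2 * C * (1 / (S * (\<Delta>t k)\<^sup>2))"
      by simp
    also have "\<dots> \<le> 2 * \<sigma>\<^sup>2 * C * ((r k)\<^sup>2 / A)"
    proof (rule mult_left_mono)
      show "1 / (S * (\<Delta>t k)\<^sup>2) \<le> (r k)\<^sup>2 / A"
        using mass A S_pos \<Delta> by (simp add: divide_simps mult_ac)
    qed (use C in auto)
    finally have variance: "2 * (\<sigma>\<^sup>2 * C / S) / (\<Delta>t k)\<^sup>2 \<le> 2 * \<sigma>\<^sup>2 * C / A * (r k)\<^sup>2" by simp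
    have "(h k + L0 * \<Delta>t k)\<^sup>2 \<le> 2 * (h k)\<^sup>2 + 2 * (L0 * \<Delta>t k)\<^sup>2"
      using sum_squares_bound[of "h k" "L0 * \<Delta>t k"] by (simp add: power2_sum)
    also have "(h k)\<^sup>2 \<le> (C1 * r k)\<^sup>2"
      using elim(1) h by (intro power_mono) auto
    finally have "2 * L1\<^sup>2 * (h k + L0 * \<Delta>t k)\<^sup>2 \<le> 2 * L1\<^sup>2 * (2 * (C1 * r k)\<^sup>2 + 2 * (L0 * \<Delta>t k)\<^sup>2)"
      by (intro mult_left_mono) auto
    then have bias: "2 * (L1 * (h k + L0 * \<Delta>t k))\<^sup>2
        \<le> 4 * L1\<^sup>2 * C1\<^sup>2 * (r k)\<^sup>2 + 4 * L1\<^sup>2 * L0\<^sup>2 * (\<Delta>t k)\<^sup>2"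
      unfolding power_mult_distrib by (simp add: distrib_left mult_ac)
    \<comment> \<open>With one constant \<open>B\<close> for both summands the product contains
      surplus terms; being nonnegative, they only enlarge the bound.\<close>
    have "0 \<le> 4 * L1\<^sup>2 * C1\<^sup>2 * (\<Delta>t k)\<^sup>2" "0 \<le> 4 * L1\<^sup>2 * L0\<^sup>2 * (r k)\<^sup>2"
      "0 \<le> 2 * \<sigma>\<^sup>2 * C / A * (\<Delta>t k)\<^sup>2"
      using C A by auto
    moreover have "B * ((r k)\<^sup>2 + (\<Delta>t k)\<^sup>2)
        = 4 * L1\<^sup>2 * C1\<^sup>2 * (r k)\<^sup>2 + 4 * L1\<^sup>2 * L0\<^sup>2 * (r k)\<^sup>2 + 2 * \<sigma>\<^sup>2 * C / A * (r k)\<^sup>2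
        + (4 * L1\<^sup>2 * C1\<^sup>2 * (\<Delta>t k)\<^sup>2 + 4 * L1\<^sup>2 * L0\<^sup>2 * (\<Delta>t k)\<^sup>2 + 2 * \<sigma>\<^sup>2 * C / A * (\<Delta>t k)\<^sup>2)"
      by (simp only: B_def distrib_left distrib_right)
    ultimately have total: "2 * (L1 * (h k + L0 * \<Delta>t k))\<^sup>2 + 2 * (\<sigma>\<^sup>2 * C / S) / (\<Delta>t k)\<^sup>2
        \<le> B * ((r k)\<^sup>2 + (\<Delta>t k)\<^sup>2)"
      using bias variance by linarith
    have "(\<integral>\<^sup>+ \<omega>. ennreal ((norm (f_hat k \<omega> (x0 k) - f k (x0 k)))\<^sup>2) \<partial>M k)
        = (\<integral>\<^sup>+ \<omega>. ennreal ((norm (\<iota>_hat k \<omega> (x0 k) /\<^sub>R \<Delta>t k - f k (x0 k)))\<^sup>2) \<partial>M k)"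
      using f_hat[OF k] by (intro nn_integral_cong) simp
    also have "\<dots> \<le> ennreal (2 * (L1 * (h k + L0 * \<Delta>t k))\<^sup>2 + 2 * (\<sigma>\<^sup>2 * C / S) / (\<Delta>t k)\<^sup>2)"
      unfolding S_def
      by (rule local_constant_mse_le[OF f_smooth[OF k] _ _ noise[OF k] _ \<Delta> h observations[OF k] K \<iota>_hat[OF k]])
        (use L_pos S_pos in \<open>auto simp: S_def\<close>)
    also have "\<dots> \<le> ennreal (B * ((r k)\<^sup>2 + (\<Delta>t k)\<^sup>2))"
      by (rule ennreal_leI[OF total])
    finally show ?case .
  qed
  moreover have "\<forall>\<^sub>F k in sequentially. 0 < (r k)\<^sup>2 + (\<Delta>t k)\<^sup>2"
    using large by eventually_elim (auto intro!: add_nonneg_pos zero_less_power step_pos)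
  moreover have "B \<ge> 0" using C A by (simp add: B_def)
  ultimately show ?thesis unfolding r_square by (rule asymp_leI)
qed

end
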